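(* For $n\geq 0$ let $A_n$ be the number of tilings of the $3\times n$ board (3 rows, $n$ columns) using unit squares and L-triominoes, where every L-triomino is a translate of the fixed shape consisting of the cells $(0,0),(1,0),(0,1)$ (column, row), i.e.\ two cells in its bottom row and one cell above the left one (no rotations or reflections allowed). Then \[ A_n=A_{n-1}+2A_{n-2}+A_{n-3}\quad(n\geq 3),\qquad A_0=1,\ A_1=1,\ A_2=3. \] *)

theory Defs
  imports Main "HOL-Library.Disjoint_Sets"
begin

text \<open>A cell is a pair (column, row), both counted from 0, rows from bottom to top.\<close>

type_synonym cell = "int \<times> int"

definition board :: "nat \<Rightarrow> cell set" where
  "board n = {0..<int n} \<times> {0..<3}"

definition translate :: "int \<times> int \<Rightarrow> cell set \<Rightarrow> cell set" where
  "translate v S = (\<lambda>(x, y). (x + fst v, y + snd v)) ` S"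

definition unit_square :: "cell set" where
  "unit_square = {(0, 0)}"

definition L_triomino :: "cell set" where
  "L_triomino = {(0, 0), (1, 0), (0, 1)}"

definition is_tile :: "cell set \<Rightarrow> bool" where
  "is_tile T \<longleftrightarrow> (\<exists>v. T = translate v unit_square \<or> T = translate v L_triomino)"

definition tilings :: "nat \<Rightarrow> cell set set set" where
  "tilings n = {P. partition_on (board n) P \<and> (\<forall>T\<in>P. is_tile T)}"

definition num_tilings :: "nat \<Rightarrow> nat" where
  "num_tilings n = card (tilings n)"

end

theory Submission imports Defs begin

text \<open>A tiling is determined by the set of lower left cells of its triominoes, and the admissible sets
  are those without two conflicting positions. Two positions in the same column conflict; in
  consecutive columns only row 0 followed by row 1 is free of conflict. Hence the maximal runs of
  columns in which a triomino starts are (in terms of the rows): none, 0, 1, or 0 followed by 1.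
  Together with the column terminating the run they give blocks of width 1, 2, 2, 3.\<close>

abbreviation L_at :: "cell \<Rightarrow> cell set" where
  "L_at v \<equiv> translate v L_triomino"

text \<open>The offsets (1, 0), (0, 1), (1, -1) are, up to sign, the nonzero differences of two
  cells of \<open>L_triomino\<close>. One sign of each suffices because (x, y) ranges over all of
  \<open>S\<close>.\<close>

definition nonoverlapping :: "cell set \<Rightarrow> bool" where
  "nonoverlapping S \<longleftrightarrow>
     (\<forall>x y. (x, y) \<in> S \<longrightarrow> (x + 1, y) \<notin> S \<and> (x, y + 1) \<notin> S \<and> (x + 1, y - 1) \<notin> S)"

text \<open>A triomino spans two columns and two rows, so its lower left cell stays off the last
  column and the top row.\<close>

definition configurations :: "nat \<Rightarrow> cell set set" where
  "configurations n = {S. S \<subseteq> {0..<int n - 1} \<times> {0..<2} \<and> nonoverlapping S}"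

definition tiling_of :: "nat \<Rightarrow> cell set \<Rightarrow> cell set set" where
  "tiling_of n S = L_at ` S \<union> (\<lambda>c. {c}) ` (board n - \<Union> (L_at ` S))"

section \<open>Translates of the triomino: fitting on the board and overlapping\<close>

lemma translate_unit_square: "translate v unit_square = {v}"
  by (simp add: translate_def unit_square_def)

lemma L_at_eq: "L_at (x, y) = {(x, y), (x + 1, y), (x, y + 1)}"
  by (auto simp: translate_def L_triomino_def)

lemma L_at_neq_singleton: "L_at v \<noteq> {c}"
  by (cases v) (auto simp: L_at_eq)

lemma inj_L_at: "inj L_at"
proof (rule injI)
  fix v w assume eq: "L_at v = L_at w"
  obtain x y x' y' where vw: "v = (x, y)" "w = (x', y')" by fastforce
  have "(x, y) \<in> L_at w" "(x + 1, y) \<in> L_at w" "(x, y + 1) \<in> L_at w"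
    unfolding eq[symmetric] by (simp_all add: vw L_at_eq)
  then show "v = w" by (auto simp: vw L_at_eq)
qed

lemma is_tile_iff: "is_tile T \<longleftrightarrow> (\<exists>c. T = {c}) \<or> T \<in> range L_at"
  by (auto simp: is_tile_def translate_unit_square)

lemma L_at_subset_board: "L_at v \<subseteq> board n \<longleftrightarrow> v \<in> {0..<int n - 1} \<times> {0..<2}"
  by (cases v) (auto simp: L_at_eq board_def)

text \<open>Two translates meet exactly when their positions differ by the difference of two cells
  of the triomino: zero, one of the offsets in \<open>nonoverlapping\<close>, or the negative of
  one.\<close>

lemma L_at_overlap_iff:
  "L_at (x, y) \<inter> L_at (x', y') \<noteq> {} \<longleftrightarrow> (x', y') = (x, y)
     \<or> (x', y') \<in> {(x + 1, y), (x, y + 1), (x + 1, y - 1)}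
     \<or> (x, y) \<in> {(x' + 1, y'), (x', y' + 1), (x' + 1, y' - 1)}"
  unfolding L_at_eq
  \<comment> \<open>Expanding the intersection cell by cell leaves a formula of linear integer
    arithmetic.\<close>
  apply (simp only: Int_insert_left Int_empty_left insert_iff prod.inject empty_iff split: if_split)
  apply (simp only: insert_not_empty not_False_eq_True simp_thms)
  apply presburger
  done

text \<open>\<open>disjoint\<close> constrains distinct sets only; by injectivity of
  \<open>L_at\<close>, distinct positions give distinct sets.\<close>

lemma disjoint_L_at_iff: "disjoint (L_at ` S) \<longleftrightarrow> nonoverlapping S"
proof -
  have "disjoint (L_at ` S) \<longleftrightarrow> (\<forall>v\<in>S. \<forall>w\<in>S. L_at v \<inter> L_at w \<noteq> {} \<longrightarrow> v = w)"
    unfolding disjoint_def by (simp add: inj_eq[OF inj_L_at]) blast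
  also have "\<dots> \<longleftrightarrow> (\<forall>x y x' y'. (x, y) \<in> S \<longrightarrow> (x', y') \<in> S \<longrightarrow>
      L_at (x, y) \<inter> L_at (x', y') \<noteq> {} \<longrightarrow> (x, y) = (x', y'))" (is "_ \<longleftrightarrow> ?R")
    by (simp only: Ball_def split_paired_All) blast
  also have "?R \<longleftrightarrow> nonoverlapping S"
  proof
    assume ?R
    then show "nonoverlapping S"
      unfolding nonoverlapping_def L_at_overlap_iff by simp blast
  next
    assume "nonoverlapping S"
    then show ?R
      unfolding nonoverlapping_def L_at_overlap_iff by blast
  qed
  finally show ?thesis .
qed

lemma configurations_iff:
  "S \<in> configurations n \<longleftrightarrow> \<Union> (L_at ` S) \<subseteq> board n \<and> disjoint (L_at ` S)"
  by (simp only: configurations_def disjoint_L_at_iff mem_Collect_eq UN_subset_iff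
      L_at_subset_board subset_eq[of S])

section \<open>Bijection between configurations and tilings\<close>

lemma tiling_of_in_tilings:
  assumes "S \<in> configurations n"
  shows "tiling_of n S \<in> tilings n"
proof -
  have S: "\<Union> (L_at ` S) \<subseteq> board n" "disjoint (L_at ` S)"
    using assms by (auto simp: configurations_iff)
  have "partition_on (\<Union> (L_at ` S)) (L_at ` S)"
    using S(2) by (auto simp: partition_on_def translate_def L_triomino_def)
  moreover have "\<Union> (tiling_of n S) = board n"
    using S(1) by (auto simp: tiling_of_def)
  moreover have "disjoint (tiling_of n S)"
    unfolding tiling_of_def
    by (intro disjoint_union S(2) partition_onD2[OF partition_on_singletons]) blast
  moreover have "{} \<notin> tiling_of n S"
    using partition_onD3[OF calculation(1)] by (auto simp: tiling_of_def)
  ultimately have "partition_on (board n) (tiling_of n S)"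
    by (simp add: partition_on_def)
  moreover have "\<forall>T\<in>tiling_of n S. is_tile T"
    by (auto simp: tiling_of_def is_tile_iff)
  ultimately show ?thesis by (simp add: tilings_def)
qed

lemma L_at_in_tiling_of: "L_at v \<in> tiling_of n S \<longleftrightarrow> v \<in> S"
  by (auto simp: tiling_of_def inj_eq[OF inj_L_at] L_at_neq_singleton)

text \<open>The triominoes of a tiling fix the rest of it: a board cell that they miss can only be
  covered by a unit square.\<close>

lemma tilings_triominoes:
  assumes P: "P \<in> tilings n" and S: "S = {v. L_at v \<in> P}"
  shows "S \<in> configurations n" and "P = tiling_of n S"
proof -
  have part: "partition_on (board n) P" and tile: "\<And>T. T \<in> P \<Longrightarrow> is_tile T"
    using P by (auto simp: tilings_def)
  have sub: "L_at ` S \<subseteq> P" using S by blast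
  have union: "\<Union> P = board n" and disj: "disjoint P"
    using part by (auto simp: partition_on_def)
  show "S \<in> configurations n"
    unfolding configurations_iff
    using Union_mono[OF sub] union pairwise_subset[OF disj sub] by simp
  have single: "{c} \<in> P \<longleftrightarrow> c \<in> board n - \<Union> (L_at ` S)" for c
  proof
    assume c: "{c} \<in> P"
    have "c \<notin> L_at v" if "v \<in> S" for v
      using disjointD[OF disj c, of "L_at v"] that L_at_neq_singleton[of v c] S by auto
    then show "c \<in> board n - \<Union> (L_at ` S)" using c union by blast
  next
    assume c: "c \<in> board n - \<Union> (L_at ` S)"
    then obtain T where T: "T \<in> P" "c \<in> T" using union by blast
    then have "T \<notin> range L_at" using c S by auto
    then obtain d where "T = {d}" using tile[OF T(1)] by (auto simp: is_tile_iff)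
    then show "{c} \<in> P" using T by simp
  qed
  show "P = tiling_of n S"
  proof (intro set_eqI iffI)
    fix T assume "T \<in> P"
    then show "T \<in> tiling_of n S"
      using tile[of T] single S by (auto simp: is_tile_iff tiling_of_def)
  next
    fix T assume "T \<in> tiling_of n S"
    then show "T \<in> P" using single sub by (auto simp: tiling_of_def)
  qed
qed

lemma bij_betw_tiling_of: "bij_betw (tiling_of n) (configurations n) (tilings n)"
proof (rule bij_betwI[where g = "\<lambda>P. {v. L_at v \<in> P}"])
  show "tiling_of n {v. L_at v \<in> P} = P" if "P \<in> tilings n" for P
    using tilings_triominoes(2)[OF that refl] by simp
qed (auto simp: tiling_of_in_tilings L_at_in_tiling_of tilings_triominoes(1)[OF _ refl])

lemma num_tilings_eq: "num_tilings n = card (configurations n)"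
  unfolding num_tilings_def using bij_betw_same_card[OF bij_betw_tiling_of] by simp

section \<open>Small boards, restriction and extension of configurations\<close>

lemma configurations_columns:
  "S \<in> configurations n \<Longrightarrow> (x, y) \<in> S \<Longrightarrow> 0 \<le> x \<and> x + 1 < int n \<and> (y = 0 \<or> y = 1)"
  by (force simp: configurations_def)

lemma finite_configurations: "finite (configurations n)"
proof (rule finite_subset)
  show "configurations n \<subseteq> Pow ({0..<int n - 1} \<times> {0..<2})"
    by (auto simp: configurations_def)
qed auto

lemma configurations_0: "configurations 0 = {{}}"
  by (auto simp: configurations_def nonoverlapping_def)

lemma configurations_1: "configurations 1 = {{}}"
  by (auto simp: configurations_def nonoverlapping_def)

lemma configurations_2: "configurations 2 = {{}, {(0, 0)}, {(0, 1)}}"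
proof -
  have "{0..<int 2 - 1} \<times> {0..<2} = {(0::int, 0::int), (0, 1)}"
    by auto
  then have "configurations 2 =
      {S \<in> {{}, {(0, 0)}, {(0, 1)}, {(0, 0), (0, 1)}}. nonoverlapping S}"
    unfolding configurations_def
    \<comment> \<open>Reading the subset condition as membership in a power set allows
      \<open>Pow_insert\<close> to enumerate the candidates.\<close>
    by (simp flip: Pow_iff) (auto simp: Pow_insert insert_commute)
  moreover have "\<not> nonoverlapping {(0, 0), (0, 1)}" "nonoverlapping {}"
    "nonoverlapping {(0, 0)}" "nonoverlapping {(0, 1)}"
    by (simp_all add: nonoverlapping_def)
  ultimately show ?thesis by auto
qed

lemma configurations_mono: "m \<le> n \<Longrightarrow> configurations m \<subseteq> configurations n"
  by (force simp: configurations_def)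

text \<open>All of \<open>S\<close> lies left of column \<open>a\<close>, so only column
  \<open>a - 1\<close> could conflict. There the assumption admits just the cell diagonally below
  (a, b), and (1, 1) is no forbidden offset.\<close>

lemma nonoverlapping_insert:
  assumes "nonoverlapping S"
    and S: "\<And>x y. (x, y) \<in> S \<Longrightarrow> x + 1 < a \<or> x + 1 = a \<and> y + 1 = b"
  shows "nonoverlapping (insert (a, b) S)"
proof -
  have right: "(a + i, y) \<notin> S" if "0 \<le> i" for i y
    using S[of "a + i" y] that by auto
  have left: "(x + 1, y) \<noteq> (a, b) \<and> (x, y + 1) \<noteq> (a, b) \<and> (x + 1, y - 1) \<noteq> (a, b)"
    if "(x, y) \<in> S" for x y
    using S[OF that] by auto
  show ?thesis
    using assms(1) right[of 0] right[of 1] left unfolding nonoverlapping_def by simp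
qed

lemma nonoverlapping_subset: "nonoverlapping S \<Longrightarrow> T \<subseteq> S \<Longrightarrow> nonoverlapping T"
  unfolding nonoverlapping_def by blast

lemma configurations_restrict:
  assumes "S \<in> configurations n" "T \<subseteq> S" "\<And>x y. (x, y) \<in> T \<Longrightarrow> x + 1 < int m"
  shows "T \<in> configurations m"
proof -
  have "v \<in> {0..<int m - 1} \<times> {0..<2}" if "v \<in> T" for v
  proof (cases v)
    case (Pair x y)
    then show ?thesis
      using assms(2,3) that configurations_columns[OF assms(1), of x y] by force
  qed
  then show ?thesis
    using assms(1,2) nonoverlapping_subset by (auto simp only: configurations_def)
qed

lemma configurations_insert:
  assumes "S \<in> configurations n" "0 \<le> a" "a + 1 < int n" "b = 0 \<or> b = 1"
    and "\<And>x y. (x, y) \<in> S \<Longrightarrow> x + 1 < a \<or> x + 1 = a \<and> y + 1 = b"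
  shows "insert (a, b) S \<in> configurations n"
  using assms(1-4) nonoverlapping_insert[OF _ assms(5)] by (auto simp: configurations_def)

text \<open>The last column in which a triomino can start is m + 1. The four sets correspond to the
  run ending there: none, 0, 1, or 0 followed by 1. Cutting off its block leaves a configuration of
  a board shorter by 1, 2, 2 or 3.\<close>

lemma configurations_rec:
  "configurations (m + 3) = configurations (m + 2)
     \<union> insert (int m + 1, 0) ` configurations (m + 1)
     \<union> insert (int m + 1, 1) ` configurations (m + 1)
     \<union> (\<lambda>S. insert (int m + 1, 1) (insert (int m, 0) S)) ` configurations m"
  (is "_ = ?A \<union> ?B \<union> ?C \<union> ?D")
proof (intro equalityI subsetI)
  fix S assume S: "S \<in> configurations (m + 3)"
  have col: "\<And>x y. (x, y) \<in> S \<Longrightarrow> x + 1 < int m + 3 \<and> (y = 0 \<or> y = 1)"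
    using configurations_columns[OF S] by auto
  have no: "nonoverlapping S" using S by (simp add: configurations_def)
  note right = no[unfolded nonoverlapping_def, rule_format, THEN conjunct1]
   and up = no[unfolded nonoverlapping_def, rule_format, THEN conjunct2, THEN conjunct1]
   and diag = no[unfolded nonoverlapping_def, rule_format, THEN conjunct2, THEN conjunct2]
  consider (none) "(int m + 1, 0) \<notin> S" "(int m + 1, 1) \<notin> S"
    | (zero) "(int m + 1, 0) \<in> S"
    | (one) "(int m + 1, 1) \<in> S" "(int m, 0) \<notin> S"
    | (both) "(int m + 1, 1) \<in> S" "(int m, 0) \<in> S" by blast
  then show "S \<in> ?A \<union> ?B \<union> ?C \<union> ?D"
  proof cases
    case none
    have "x + 1 < int (m + 2)" if "(x, y) \<in> S" for x y
      using col[OF that] none that by (cases "x = int m + 1") auto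
    then show ?thesis using configurations_restrict[OF S subset_refl] by simp
  next
    case zero
    \<comment> \<open>Position (m + 1, 0) rules out both rows of column m: row 0 by the horizontal
      offset, row 1 by the diagonal one.\<close>
    have n: "(int m + 1, 1) \<notin> S" "(int m, 0) \<notin> S" "(int m, 1) \<notin> S"
      using up[OF zero] right[of "int m" 0] diag[of "int m" 1] zero by auto
    have "x + 1 < int (m + 1)" if "(x, y) \<in> S - {(int m + 1, 0)}" for x y
      using col[of x y] n that by (cases "x = int m + 1"; cases "x = int m") auto
    then have "S - {(int m + 1, 0)} \<in> configurations (m + 1)"
      by (rule configurations_restrict[OF S Diff_subset])
    then have "S \<in> ?B"
      by (rule image_eqI[rotated]) (use zero in auto)
    then show ?thesis by simp
  next
    case one
    have n: "(int m + 1, 0) \<notin> S" "(int m, 1) \<notin> S"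
      using up[of "int m + 1" 0] right[of "int m" 1] one by auto
    have "x + 1 < int (m + 1)" if "(x, y) \<in> S - {(int m + 1, 1)}" for x y
      using col[of x y] n one that by (cases "x = int m + 1"; cases "x = int m") auto
    then have "S - {(int m + 1, 1)} \<in> configurations (m + 1)"
      by (rule configurations_restrict[OF S Diff_subset])
    then have "S \<in> ?C"
      by (rule image_eqI[rotated]) (use one in auto)
    then show ?thesis by simp
  next
    case both
    \<comment> \<open>Here (m, 0) rules out both rows of column m - 1, so all remaining positions
      lie further left.\<close>
    have n: "(int m + 1, 0) \<notin> S" "(int m, 1) \<notin> S" "(int m - 1, 0) \<notin> S" "(int m - 1, 1) \<notin> S"
      using up[of "int m + 1" 0] right[of "int m" 1] right[of "int m - 1" 0]
        diag[of "int m - 1" 1] both by auto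
    let ?T = "S - {(int m + 1, 1), (int m, 0)}"
    have "x + 1 < int m" if "(x, y) \<in> ?T" for x y
      using col[of x y] n that
      by (cases "x = int m + 1"; cases "x = int m"; cases "x = int m - 1") auto
    then have "?T \<in> configurations m"
      by (rule configurations_restrict[OF S Diff_subset])
    then have "S \<in> ?D"
      by (rule image_eqI[rotated]) (use both in auto)
    then show ?thesis by simp
  qed
next
  fix S assume "S \<in> ?A \<union> ?B \<union> ?C \<union> ?D"
  then consider "S \<in> ?A"
    | T b where "T \<in> configurations (m + 1)" "b \<in> {0, 1}" "S = insert (int m + 1, b) T"
    | T where "T \<in> configurations m" "S = insert (int m + 1, 1) (insert (int m, 0) T)"
    by auto
  then show "S \<in> configurations (m + 3)"
  proof cases
    case 1
    then show ?thesis using configurations_mono[of "m + 2" "m + 3"] by auto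
  next
    case (2 T b)
    note T = configurations_columns[OF 2(1)]
    have "T \<in> configurations (m + 3)"
      using 2(1) configurations_mono[of "m + 1" "m + 3"] by auto
    then show ?thesis
      unfolding 2(3) by (rule configurations_insert) (use 2(2) in \<open>auto dest: T\<close>)
  next
    case (3 T)
    note T = configurations_columns[OF 3(1)]
    have "T \<in> configurations (m + 3)"
      using 3(1) configurations_mono[of m "m + 3"] by auto
    \<comment> \<open>Inserting from left to right fits \<open>configurations_insert\<close>: at the
      second insertion, (m, 0) is the permitted cell diagonally below (m + 1, 1).\<close>
    then have "insert (int m, 0) T \<in> configurations (m + 3)"
      by (rule configurations_insert) (auto dest: T)
    then show ?thesis
      unfolding 3(2) by (rule configurations_insert) (auto dest: T)
  qed
qed

lemma card_configurations_rec:
  "card (configurations (m + 3)) =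
     card (configurations (m + 2)) + 2 * card (configurations (m + 1)) + card (configurations m)"
proof -
  let ?i = "\<lambda>b. insert (int m + 1, b :: int)"
  let ?j = "\<lambda>S. insert (int m + 1, 1 :: int) (insert (int m, 0 :: int) S)"
  let ?A = "configurations (m + 2)" and ?B = "?i 0 ` configurations (m + 1)"
    and ?C = "?i 1 ` configurations (m + 1)" and ?D = "?j ` configurations m"
  have fin: "finite ?A" "finite ?B" "finite ?C" "finite ?D"
    by (auto simp: finite_configurations)
  have A: "(int m + 1, b) \<notin> S" if "S \<in> ?A" for S b
    using configurations_columns[OF that] by fastforce
  have B: "(int m + 1, b) \<notin> S" "(int m, b) \<notin> S" if "S \<in> configurations (m + 1)" for S b
    using configurations_columns[OF that] by fastforce+
  have D: "(int m + 1, b) \<notin> S" "(int m, b) \<notin> S" if "S \<in> configurations m" for S b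
    using configurations_columns[OF that] by fastforce+
  \<comment> \<open>Membership of (m + 1, 0), (m + 1, 1) and (m, 0) tells the four sets
    apart.\<close>
  have inB: "(int m + 1, 0) \<in> S \<and> (int m + 1, 1) \<notin> S" if "S \<in> ?B" for S
    using that B by auto
  have inC: "(int m + 1, 1) \<in> S \<and> (int m, 0) \<notin> S" if "S \<in> ?C" for S
    using that B by auto
  have inD: "(int m + 1, 1) \<in> S \<and> (int m, 0) \<in> S" if "S \<in> ?D" for S
    using that by auto
  have "?A \<inter> ?B = {}" "(?A \<union> ?B) \<inter> ?C = {}" "(?A \<union> ?B \<union> ?C) \<inter> ?D = {}"
    using A inB inC inD by blast+
  then have "card (?A \<union> ?B \<union> ?C \<union> ?D) = card ?A + card ?B + card ?C + card ?D"
    using fin by (simp add: card_Un_disjoint)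
  \<comment> \<open>The inserted positions lie in columns that the smaller configurations do not
    reach, so deleting them inverts the insertion.\<close>
  moreover have "card (?i b ` configurations (m + 1)) = card (configurations (m + 1))" for b
    by (rule card_image, rule inj_on_inverseI[where g = "\<lambda>S. S - {(int m + 1, b)}"])
      (use B in auto)
  moreover have "card ?D = card (configurations m)"
    by (rule card_image,
        rule inj_on_inverseI[where g = "\<lambda>S. S - {(int m + 1, 1), (int m, 0)}"])
      (use D in auto)
  ultimately show ?thesis unfolding configurations_rec by simp
qed

theorem theorem2p2:
  shows "(\<forall>n\<ge>3. num_tilings n = num_tilings (n - 1) + 2 * num_tilings (n - 2) + num_tilings (n - 3)) \<and> num_tilings 0 = 1 \<and> num_tilings 1 = 1 \<and> num_tilings 2 = 3"
proof (intro conjI allI impI)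
  fix n :: nat assume "n \<ge> 3"
  then obtain m where "n = m + 3" by (metis add.commute le_iff_add)
  then show "num_tilings n = num_tilings (n - 1) + 2 * num_tilings (n - 2) + num_tilings (n - 3)"
    using card_configurations_rec[of m] by (simp add: num_tilings_eq)
\<comment> \<open>\<open>simplified\<close> turns the argument 1 into \<open>Suc 0\<close>, the form
  in which the goal appears during simplification.\<close>
qed (simp_all add: num_tilings_eq configurations_0 configurations_1[simplified] configurations_2)

end
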